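(* The Sperner systems $\mathcal{U}^{2m+1}_1$ and $\mathcal{U}^{2m+1}_2$ are nonisomorphic, and $\mathcal{U}^{2m+2}_1$ and $\mathcal{U}^{2m+2}_2$ are nonisomorphic, for every $m\ge 3$.
   Context: A set system over a finite set $A$ (the ground set) is a set of subsets of $A$, called blocks; it is a Sperner system if no block is included in another. Set systems $\mathcal A$ over $A$ and $\mathcal B$ over $B$ are isomorphic if there is a bijection $\sigma\colon A\to B$ with $\{\sigma(S):S\in\mathcal A\}=\mathcal B$. Let $[m]=\{1,\dots,m\}$. For each $n\in[m]$ let $n'$ be a new element (a primed copy of $n$), and $S'=\{n':n\in S\}$ for $S\subseteq[m]$. Let $E_m=[m]\cup[m]'$, a set with $2m$ elements. Addition of elements of $[m]$ is modulo $m$ with result taken in $[m]$. For $J\subseteq[m]$ let $F^m_J=J\cup([m]\setminus J)'$. Put $\mathcal F^m_1=\{F^m_J: J\subseteq[m],\ |J|\text{ odd}\}$ and $\mathcal F^m_2=\{F^m_J: J\subseteq[m],\ |J|\text{ even}\}$. For $p\in[m]$ let $G^m_p=E_m\setminus\{p,p',(p+1)'\}$ and $\mathcal G^m=\{G^m_p:p\in[m]\}$. For $i\in\{1,2\}$, $\mathcal M^m_i=\mathcal F^m_i\cup\mathcal G^m$, a Sperner system over $E_m$. Let $0,0'$ be two further distinct elements not in $E_m$. For $m\ge3$ and $i\in\{1,2\}$, $\mathcal U^{2m+1}_i=\{S\cup\{0\}:S\in\mathcal M^m_i\}$, a Sperner system over $E_m\cup\{0\}$, and $\mathcal U^{2m+2}_i=\mathcal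 U^{2m+1}_i\cup\{\{0,0'\}\}$, a Sperner system over $E_m\cup\{0,0'\}$. *)

theory Defs
  imports Main
begin

definition set_system :: "'a set \<Rightarrow> 'a set set \<Rightarrow> bool" where
  "set_system A \<A> \<longleftrightarrow> finite A \<and> \<A> \<subseteq> Pow A"

definition sperner_system :: "'a set \<Rightarrow> 'a set set \<Rightarrow> bool" where
  "sperner_system A \<A> \<longleftrightarrow> set_system A \<A> \<and> (\<forall>S\<in>\<A>. \<forall>T\<in>\<A>. S \<subseteq> T \<longrightarrow> S = T)"

definition isomorphic_systems :: "'a set \<Rightarrow> 'a set set \<Rightarrow> 'b set \<Rightarrow> 'b set set \<Rightarrow> bool" where
  "isomorphic_systems A \<A> B \<B> \<longleftrightarrow> (\<exists>\<sigma>. bij_betw \<sigma> A B \<and> {\<sigma> ` S | S. S \<in> \<A>} = \<B>)"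

text \<open>
  \<open>Plain n\<close> stands for \<open>n\<close> and \<open>Primed n\<close> for its primed copy \<open>n'\<close>. Since \<open>[m] = {1..m}\<close>,
  the elements \<open>Plain 0\<close> and \<open>Primed 0\<close> are outside every \<open>E_set m\<close>; they serve as
  the two additional elements \<open>0\<close> and \<open>0'\<close>.
\<close>

datatype elem = Plain nat | Primed nat

definition E_set :: "nat \<Rightarrow> elem set" where
  "E_set m = Plain ` {1..m} \<union> Primed ` {1..m}"

definition add_mod :: "nat \<Rightarrow> nat \<Rightarrow> nat \<Rightarrow> nat" where
  "add_mod m a b = (if (a + b) mod m = 0 then m else (a + b) mod m)"

definition F_block :: "nat \<Rightarrow> nat set \<Rightarrow> elem set" where
  "F_block m J = Plain ` J \<union> Primed ` ({1..m} - J)"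

text \<open>In the following the lower index \<open>i\<close> is meant to be 1 or 2.\<close>

definition F_system :: "nat \<Rightarrow> nat \<Rightarrow> elem set set" where
  "F_system m i =
     {F_block m J | J. J \<subseteq> {1..m} \<and> (if i = 1 then odd (card J) else even (card J))}"

definition G_block :: "nat \<Rightarrow> nat \<Rightarrow> elem set" where
  "G_block m p = E_set m - {Plain p, Primed p, Primed (add_mod m p 1)}"

definition G_system :: "nat \<Rightarrow> elem set set" where
  "G_system m = {G_block m p | p. p \<in> {1..m}}"

definition M_system :: "nat \<Rightarrow> nat \<Rightarrow> elem set set" where
  "M_system m i = F_system m i \<union> G_system m"

text \<open>
  \<open>U_odd m i\<close> is the system with upper index \<open>2m+1\<close>, over \<open>U_odd_ground m\<close>, and
  \<open>U_even m i\<close> the one with upper index \<open>2m+2\<close>, over \<open>U_even_ground m\<close>.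
\<close>

definition U_odd_ground :: "nat \<Rightarrow> elem set" where
  "U_odd_ground m = E_set m \<union> {Plain 0}"

definition U_odd :: "nat \<Rightarrow> nat \<Rightarrow> elem set set" where
  "U_odd m i = {S \<union> {Plain 0} | S. S \<in> M_system m i}"

definition U_even_ground :: "nat \<Rightarrow> elem set" where
  "U_even_ground m = E_set m \<union> {Plain 0, Primed 0}"

definition U_even :: "nat \<Rightarrow> nat \<Rightarrow> elem set set" where
  "U_even m i = U_odd m i \<union> {{Plain 0, Primed 0}}"

lemma sperner_systemI:
  assumes "finite A" "\<A> \<subseteq> Pow A" "\<And>S T. S \<in> \<A> \<Longrightarrow> T \<in> \<A> \<Longrightarrow> S \<subseteq> T \<Longrightarrow> S = T"
  shows "sperner_system A \<A>"
  unfolding sperner_system_def set_system_def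
proof (intro conjI ballI impI)
  fix S T assume "S \<in> \<A>" "T \<in> \<A>" "S \<subseteq> T"
  then show "S = T" by (rule assms(3))
qed (fact assms(1,2))+

lemma sperner_systemD:
  assumes "sperner_system A \<A>"
  shows "finite A" "\<A> \<subseteq> Pow A" "\<forall>S\<in>\<A>. \<forall>T\<in>\<A>. S \<subseteq> T \<longrightarrow> S = T"
  using assms by (simp_all add: sperner_system_def set_system_def)

lemma F_block_iff:
  "Plain x \<in> F_block m J \<longleftrightarrow> x \<in> J"
  "Primed x \<in> F_block m J \<longleftrightarrow> x \<in> {1..m} \<and> x \<notin> J"
  by (auto simp: F_block_def)

lemma G_block_iff:
  "Plain x \<in> G_block m p \<longleftrightarrow> x \<in> {1..m} \<and> x \<noteq> p"
  "Primed x \<in> G_block m p \<longleftrightarrow> x \<in> {1..m} \<and> x \<noteq> p \<and> x \<noteq> add_mod m p 1"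
  by (auto simp: G_block_def E_set_def)

lemma M_system_cases:
  assumes "S \<in> M_system m i"
  shows "(\<exists>J\<subseteq>{1..m}. S = F_block m J) \<or> (\<exists>p\<in>{1..m}. S = G_block m p)"
proof (cases "S \<in> F_system m i")
  case True
  then obtain J where "J \<subseteq> {1..m}" "S = F_block m J" unfolding F_system_def mem_Collect_eq by (elim exE conjE)
  then show ?thesis by blast
next
  case False
  then have "S \<in> G_system m" using assms by (simp add: M_system_def)
  then obtain p where "p \<in> {1..m}" "S = G_block m p" unfolding G_system_def mem_Collect_eq by (elim exE conjE)
  then show ?thesis by blast
qed

lemma sperner_M:
  assumes m: "m \<ge> 3"
  shows "sperner_system (E_set m) (M_system m i)"
proof -
  have sub: "M_system m i \<subseteq> Pow (E_set m)"
    by (auto simp: M_system_def F_system_def G_system_def F_block_def G_block_def E_set_def)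
  have FF: "F_block m J = F_block m K"
    if "J \<subseteq> {1..m}" "K \<subseteq> {1..m}" "F_block m J \<subseteq> F_block m K" for J K
  proof -
    have "x \<in> J \<longleftrightarrow> x \<in> K" for x
      using that(1,2) subsetD[OF that(3), of "Plain x"] subsetD[OF that(3), of "Primed x"]
      unfolding F_block_iff by blast
    then have "J = K" by blast
    then show ?thesis by simp
  qed
  have FG: "\<not> F_block m J \<subseteq> G_block m p" if "p \<in> {1..m}" for J p
  proof
    assume "F_block m J \<subseteq> G_block m p"
    from subsetD[OF this, of "Plain p"] subsetD[OF this, of "Primed p"] show False
      using that by (auto simp: F_block_iff G_block_iff)
  qed
  have GF: "\<not> G_block m p \<subseteq> F_block m J" if p: "p \<in> {1..m}" for J p
  proof -
    obtain q where "q \<in> {1, 2, 3}" "q \<noteq> p" "q \<noteq> add_mod m p 1"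
    proof -
      have "(1 \<noteq> p \<and> 1 \<noteq> a) \<or> (2 \<noteq> p \<and> 2 \<noteq> a) \<or> (3 \<noteq> p \<and> 3 \<noteq> a)" for a :: nat by auto
      from this[of "add_mod m p 1"] that show thesis by blast
    qed
    then have "q \<in> {1..m}" "q \<noteq> p" "q \<noteq> add_mod m p 1" using m by auto
    then have "Plain q \<in> G_block m p" "Primed q \<in> G_block m p"
      by (simp_all add: G_block_iff)
    moreover have "Plain q \<notin> F_block m J \<or> Primed q \<notin> F_block m J"
      by (simp add: F_block_iff)
    ultimately show ?thesis by (meson subsetD)
  qed
  have GG: "p = q" if "p \<in> {1..m}" "q \<in> {1..m}" "G_block m p \<subseteq> G_block m q" for p q
    using subsetD[OF that(3), of "Plain q"] that(2) by (auto simp: G_block_iff)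
  have eq: "S = T" if ST: "S \<in> M_system m i" "T \<in> M_system m i" "S \<subseteq> T" for S T
  proof -
    have S: "(\<exists>J\<subseteq>{1..m}. S = F_block m J) \<or> (\<exists>p\<in>{1..m}. S = G_block m p)"
      using ST(1) by (rule M_system_cases)
    have T: "(\<exists>J\<subseteq>{1..m}. T = F_block m J) \<or> (\<exists>p\<in>{1..m}. T = G_block m p)"
      using ST(2) by (rule M_system_cases)
    from S show ?thesis
    proof (elim disjE bexE exE conjE)
      fix J assume J: "J \<subseteq> {1..m}" "S = F_block m J"
      from T show ?thesis
      proof (elim disjE bexE exE conjE)
        fix K assume "K \<subseteq> {1..m}" "T = F_block m K"
        then show ?thesis using FF[of J K] J ST(3) by simp
      next
        fix q assume "q \<in> {1..m}" "T = G_block m q"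
        then show ?thesis using FG[of q J] J ST(3) by simp
      qed
    next
      fix p assume p: "p \<in> {1..m}" "S = G_block m p"
      from T show ?thesis
      proof (elim disjE bexE exE conjE)
        fix K assume "K \<subseteq> {1..m}" "T = F_block m K"
        then show ?thesis using GF[of p K] p ST(3) by simp
      next
        fix q assume "q \<in> {1..m}" "T = G_block m q"
        then show ?thesis using GG[of p q] p ST(3) by simp
      qed
    qed
  qed
  have "finite (E_set m)" by (simp add: E_set_def)
  then show ?thesis using sub eq by (rule sperner_systemI)
qed

lemma sperner_U_odd:
  assumes m: "m \<ge> 3"
  shows "sperner_system (U_odd_ground m) (U_odd m i)"
proof -
  note sub = sperner_systemD(2)[OF sperner_M[OF m, of i]]
    and fin = sperner_systemD(1)[OF sperner_M[OF m, of i]]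
    and sp = sperner_systemD(3)[OF sperner_M[OF m, of i]]
  have z: "Plain 0 \<notin> E_set m" by (auto simp: E_set_def)
  have eq: "S = T" if ST: "S \<in> U_odd m i" "T \<in> U_odd m i" "S \<subseteq> T" for S T
  proof -
    obtain S' T' where *: "S = S' \<union> {Plain 0}" "S' \<in> M_system m i"
      "T = T' \<union> {Plain 0}" "T' \<in> M_system m i"
      using ST unfolding U_odd_def by blast
    have "Plain 0 \<notin> S'" using * sub z by blast
    then have "S' \<subseteq> T'" using * ST(3) by blast
    then have "S' = T'" using * sp by blast
    then show ?thesis using * by simp
  qed
  have "finite (U_odd_ground m)" using fin by (simp add: U_odd_ground_def)
  moreover have "U_odd m i \<subseteq> Pow (U_odd_ground m)"
    using sub unfolding U_odd_def U_odd_ground_def by blast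
  ultimately show ?thesis using eq by (rule sperner_systemI)
qed

lemma sperner_U_even:
  assumes m: "m \<ge> 3"
  shows "sperner_system (U_even_ground m) (U_even m i)"
proof -
  note sub = sperner_systemD(2)[OF sperner_U_odd[OF m, of i]]
    and sp = sperner_systemD(3)[OF sperner_U_odd[OF m, of i]]
  have z: "Primed 0 \<notin> U_odd_ground m" by (auto simp: U_odd_ground_def E_set_def)
  have n: "\<not> S \<subseteq> {Plain 0, Primed 0}" if S: "S \<in> U_odd m i" for S
  proof -
    obtain S' where S': "S = S' \<union> {Plain 0}" "S' \<in> M_system m i"
      using S by (auto simp: U_odd_def)
    have "\<exists>x\<in>S'. x \<noteq> Plain 0 \<and> x \<noteq> Primed 0"
    proof (cases "S' \<in> F_system m i")
      case True
      then obtain J where J: "S' = F_block m J" by (auto simp: F_system_def)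
      have "1 \<in> {1..m}" using m by simp
      then have "Plain 1 \<in> S' \<or> Primed 1 \<in> S'" unfolding J F_block_iff by blast
      then show ?thesis by (elim disjE) (rule bexI, simp_all)+
    next
      case False
      then obtain p where p: "S' = G_block m p"
        using S' by (auto simp: M_system_def G_system_def)
      have "Plain 1 \<in> S' \<or> Plain 2 \<in> S'" using m unfolding p G_block_iff by simp
      then show ?thesis by (elim disjE) (rule bexI, simp_all)+
    qed
    then show ?thesis using S' by auto
  qed
  have z': "\<not> {Plain 0, Primed 0} \<subseteq> T" if "T \<in> U_odd m i" for T
    using that sub z by blast
  have eq: "S = T" if ST: "S \<in> U_even m i" "T \<in> U_even m i" "S \<subseteq> T" for S T
  proof -
    have "S \<in> U_odd m i \<or> S = {Plain 0, Primed 0}" "T \<in> U_odd m i \<or> T = {Plain 0, Primed 0}"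
      using ST(1,2) unfolding U_even_def by auto
    then show ?thesis using ST(3) sp n[of S] z'[of T] by metis
  qed
  have "finite (U_even_ground m)"
    by (simp add: U_even_ground_def E_set_def)
  moreover have "U_even m i \<subseteq> Pow (U_even_ground m)"
    using sub unfolding U_even_def U_odd_ground_def U_even_ground_def by blast
  ultimately show ?thesis using eq by (rule sperner_systemI)
qed

end

theory Submission
  imports Defs
begin

text \<open>
  The number of blocks containing an element is an isomorphism invariant. Exchanging \<open>n\<close> and
  \<open>n'\<close> together with \<open>k\<close> and \<open>k'\<close> preserves the parity of \<open>J\<close>, so \<open>n\<close> and \<open>n'\<close> each lie in
  exactly half of the blocks \<open>F_J\<close>. But \<open>n\<close> is missing from one block \<open>G_p\<close>, and \<open>n'\<close> from two.
  Hence an isomorphism maps unprimed elements of \<open>E_m\<close> to unprimed ones. The first system has a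
  block with exactly one unprimed element of \<open>E_m\<close>, namely the one from \<open>F_J\<close> with \<open>J = {1}\<close>.
  The second one has none: such a block would come from some \<open>F_J\<close> with \<open>|J|\<close> even, or
  from a \<open>G_p\<close>, with its \<open>m - 1 > 1\<close> unprimed elements.
\<close>

section \<open>Degrees under isomorphisms\<close>

definition degree :: "'a set set \<Rightarrow> 'a \<Rightarrow> nat" where
  "degree \<A> x = card {S \<in> \<A>. x \<in> S}"

text \<open>As all blocks lie inside \<open>A\<close>, where \<open>\<sigma>\<close> is injective,
  distinct blocks have distinct images, and \<open>\<sigma> x\<close> lies in the image of a block
  only if \<open>x\<close> lies in the block.\<close>

lemma isomorphic_systems_degree:
  assumes "isomorphic_systems A \<A> B \<B>" "\<A> \<subseteq> Pow A"
  obtains \<sigma> where "inj_on \<sigma> A" "\<B> = (`) \<sigma> ` \<A>" "card \<B> = card \<A>"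
    "\<And>x. x \<in> A \<Longrightarrow> degree \<B> (\<sigma> x) = degree \<A> x"
proof -
  obtain \<sigma> where \<sigma>: "bij_betw \<sigma> A B" "\<B> = (`) \<sigma> ` \<A>"
    using assms(1) by (auto simp: isomorphic_systems_def)
  have inj: "inj_on \<sigma> A" using \<sigma>(1) by (rule bij_betw_imp_inj_on)
  then have inj': "inj_on ((`) \<sigma>) \<A>"
    using inj_on_image_Pow inj_on_subset assms(2) by blast
  have "degree \<B> (\<sigma> x) = degree \<A> x" if "x \<in> A" for x
  proof -
    have "{T \<in> \<B>. \<sigma> x \<in> T} = (`) \<sigma> ` {S \<in> \<A>. x \<in> S}"
    proof -
      have "\<sigma> x \<in> \<sigma> ` S \<longleftrightarrow> x \<in> S" if "S \<in> \<A>" for S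
        using that \<open>x \<in> A\<close> assms(2) inj by (meson PowD inj_on_image_mem_iff subsetD)
      then show ?thesis unfolding \<sigma>(2) by blast
    qed
    moreover have "inj_on ((`) \<sigma>) {S \<in> \<A>. x \<in> S}"
      using inj' by (rule inj_on_subset) blast
    ultimately show ?thesis by (simp add: degree_def card_image)
  qed
  then show thesis using that[OF inj \<sigma>(2)] card_image[OF inj'] \<sigma>(2) by blast
qed

text \<open>Both arguments of \<open>Q\<close> are invariants, so the image of \<open>S\<close>
  serves as \<open>T\<close>. The number of blocks is an argument because the equation that singles
  out the unprimed elements refers to it.\<close>

lemma isomorphic_systems_block_degrees:
  assumes iso: "isomorphic_systems A \<A> B \<B>" and sub: "\<A> \<subseteq> Pow A" and "S \<in> \<A>"
  shows "\<exists>T\<in>\<B>. card {y \<in> T. Q (card \<B>) (degree \<B> y)} = card {x \<in> S. Q (card \<A>) (degree \<A> x)}"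
proof -
  obtain \<sigma> where \<sigma>: "inj_on \<sigma> A" "\<B> = (`) \<sigma> ` \<A>" "card \<B> = card \<A>"
    "\<And>x. x \<in> A \<Longrightarrow> degree \<B> (\<sigma> x) = degree \<A> x"
    using isomorphic_systems_degree[OF iso sub] by metis
  have S: "S \<subseteq> A" using assms by blast
  then have "{y \<in> \<sigma> ` S. Q (card \<B>) (degree \<B> y)} = \<sigma> ` {x \<in> S. Q (card \<A>) (degree \<A> x)}"
    using \<sigma>(3,4) by auto
  moreover have "inj_on \<sigma> {x \<in> S. Q (card \<A>) (degree \<A> x)}"
    using \<sigma>(1) by (rule inj_on_subset) (use S in blast)
  ultimately have "card {y \<in> \<sigma> ` S. Q (card \<B>) (degree \<B> y)} = card {x \<in> S. Q (card \<A>) (degree \<A> x)}"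
    by (simp add: card_image)
  then show ?thesis using \<open>S \<in> \<A>\<close> \<sigma>(2) by blast
qed

section \<open>Degrees after a disjoint union and after adding a common element\<close>

lemma degree_Un_disjoint:
  assumes "finite \<A>" "finite \<B>" "\<A> \<inter> \<B> = {}"
  shows "degree (\<A> \<union> \<B>) x = degree \<A> x + degree \<B> x"
proof -
  have "{S \<in> \<A> \<union> \<B>. x \<in> S} = {S \<in> \<A>. x \<in> S} \<union> {S \<in> \<B>. x \<in> S}" by blast
  then show ?thesis unfolding degree_def using assms by (simp add: card_Un_disjoint disjoint_iff)
qed

lemma inj_on_insert_new:
  assumes "z \<notin> \<Union>\<A>"
  shows "inj_on (insert z) \<A>"
  using assms by (intro inj_onI) (metis UnionI insert_ident)

lemma degree_insert_new:
  assumes "z \<notin> \<Union>\<A>"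
  shows "degree (insert z ` \<A>) x = (if x = z then card \<A> else degree \<A> x)"
proof -
  have "{S \<in> insert z ` \<A>. x \<in> S} = insert z ` (if x = z then \<A> else {S \<in> \<A>. x \<in> S})"
    by auto
  moreover have "inj_on (insert z) (if x = z then \<A> else {S \<in> \<A>. x \<in> S})"
    using inj_on_insert_new[OF assms] by (rule inj_on_subset) auto
  ultimately show ?thesis by (simp add: degree_def card_image split: if_splits)
qed

section \<open>Indexing of the blocks \<open>F_J\<close> and \<open>G_p\<close>\<close>

lemma add_mod_1:
  assumes "p \<in> {1..m}" "m \<ge> 2"
  shows "add_mod m p 1 = (if p = m then 1 else Suc p)"
  using assms by (cases "p = m"; cases "Suc p = m") (auto simp: add_mod_def mod_Suc)

lemma inj_on_F_block: "inj_on (F_block m) (Pow {1..m})"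
proof (rule inj_onI)
  fix J K assume eq: "F_block m J = F_block m K"
  have "x \<in> J \<longleftrightarrow> x \<in> K" for x
    using F_block_iff(1)[of x m J] F_block_iff(1)[of x m K] unfolding eq by simp
  then show "J = K" by blast
qed

lemma inj_on_G_block: "inj_on (G_block m) {1..m}"
proof (rule inj_onI)
  fix p q assume "p \<in> {1..m}" and eq: "G_block m p = G_block m q"
  then show "p = q"
    using G_block_iff(1)[of p m p] G_block_iff(1)[of p m q] unfolding eq by simp
qed

lemma finite_F_system: "finite (F_system m i)"
proof -
  have "F_system m i \<subseteq> F_block m ` Pow {1..m}" by (auto simp: F_system_def)
  then show ?thesis by (rule finite_subset) simp
qed

lemma G_system_image: "G_system m = G_block m ` {1..m}"
  by (auto simp: G_system_def)

text \<open>\<open>F_block m J\<close> contains one of \<open>Plain p\<close> and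
  \<open>Primed p\<close>, while \<open>G_block m p\<close> contains neither.\<close>

lemma F_G_disjoint: "F_system m i \<inter> G_system m = {}"
proof -
  have "F_block m J \<noteq> G_block m p" if "p \<in> {1..m}" for J p
  proof
    assume eq: "F_block m J = G_block m p"
    show False
      using that F_block_iff[of p m J] unfolding eq G_block_iff by simp
  qed
  then show ?thesis unfolding F_system_def G_system_def by blast
qed

section \<open>Degrees in \<open>F_system\<close> and \<open>G_system\<close>\<close>

lemma even_card_sym_diff_pair:
  assumes "finite J" "n \<noteq> k"
  shows "even (card (sym_diff J {n, k})) \<longleftrightarrow> even (card J)"
proof -
  have "card (sym_diff J {n, k}) + 2 * card (J \<inter> {n, k}) = card J + card {n, k}"
  proof -
    have "card (sym_diff J {n, k}) = card (J - {n, k}) + card ({n, k} - J)"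
      using assms by (intro card_Un_disjoint) auto
    moreover have "card J = card (J - {n, k}) + card (J \<inter> {n, k})"
      using card_Int_Diff[OF assms(1), of "{n, k}"] by simp
    moreover have "card {n, k} = card ({n, k} - J) + card (J \<inter> {n, k})"
      using card_Int_Diff[of "{n, k}" J] by (simp only: finite.intros Int_commute add.commute)
    ultimately show ?thesis by simp
  qed
  moreover have "card {n, k} = 2" using assms by simp
  ultimately show ?thesis by presburger
qed

lemma degree_F_Plain_Primed:
  assumes "m \<ge> 2" "n \<in> {1..m}"
  shows "degree (F_system m i) (Plain n) = degree (F_system m i) (Primed n)"
proof -
  define X where "X = {J. J \<subseteq> {1..m} \<and> (if i = 1 then odd (card J) else even (card J))}"
  \<comment> \<open>Flipping \<open>n\<close> alone would change the parity of
    \<open>card J\<close>, so a second index is flipped too. Any index other than \<open>n\<close>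
    would do; \<open>m \<ge> 2\<close> provides one.\<close>
  define k :: nat where "k = (if n = 1 then 2 else 1)"
  have k: "k \<in> {1..m}" "n \<noteq> k" using assms by (auto simp: k_def)
  have F: "F_system m i = F_block m ` X" by (auto simp: F_system_def X_def)
  have deg: "degree (F_system m i) x = card {J \<in> X. x \<in> F_block m J}" for x
  proof -
    have "{S \<in> F_system m i. x \<in> S} = F_block m ` {J \<in> X. x \<in> F_block m J}"
      unfolding F by blast
    moreover have "inj_on (F_block m) {J \<in> X. x \<in> F_block m J}"
      using inj_on_F_block by (rule inj_on_subset) (auto simp: X_def)
    ultimately show ?thesis by (simp add: degree_def card_image)
  qed
  have X: "sym_diff J {n, k} \<in> X" if "J \<in> X" for J
  proof -
    have "finite J" using that by (auto simp: X_def intro: finite_subset)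
    then show ?thesis
      using that assms(2) k even_card_sym_diff_pair[of J n k] by (auto simp: X_def)
  qed
  \<comment> \<open>On index sets the exchange is the symmetric difference with
    \<open>{n, k}\<close>, an involution and hence its own inverse.\<close>
  have "bij_betw (\<lambda>J. sym_diff J {n, k}) {J \<in> X. Plain n \<in> F_block m J} {J \<in> X. Primed n \<in> F_block m J}"
  proof (rule bij_betw_byWitness[where f' = "\<lambda>J. sym_diff J {n, k}"])
    show "\<forall>J\<in>{J \<in> X. Plain n \<in> F_block m J}. sym_diff (sym_diff J {n, k}) {n, k} = J"
      "\<forall>J\<in>{J \<in> X. Primed n \<in> F_block m J}. sym_diff (sym_diff J {n, k}) {n, k} = J"
      by blast+
    have "Primed n \<in> F_block m (sym_diff J {n, k}) \<longleftrightarrow> Plain n \<in> F_block m J"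
      "Plain n \<in> F_block m (sym_diff J {n, k}) \<longleftrightarrow> Primed n \<in> F_block m J" for J
      using assms(2) unfolding F_block_iff by blast+
    then show "(\<lambda>J. sym_diff J {n, k}) ` {J \<in> X. Plain n \<in> F_block m J} \<subseteq> {J \<in> X. Primed n \<in> F_block m J}"
      "(\<lambda>J. sym_diff J {n, k}) ` {J \<in> X. Primed n \<in> F_block m J} \<subseteq> {J \<in> X. Plain n \<in> F_block m J}"
      using X by blast+
  qed
  then show ?thesis unfolding deg by (rule bij_betw_same_card)
qed

text \<open>Each block \<open>F_J\<close> contains exactly one of \<open>n\<close> and
  \<open>n'\<close>, and the two have equal degree.\<close>

lemma card_F_system:
  assumes "m \<ge> 2" "n \<in> {1..m}"
  shows "card (F_system m i) = 2 * degree (F_system m i) (Plain n)"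
proof -
  have iff: "Primed n \<in> S \<longleftrightarrow> Plain n \<notin> S" if "S \<in> F_system m i" for S
    using that assms(2) by (auto simp: F_system_def F_block_iff)
  have "F_system m i \<inter> {S. Plain n \<in> S} = {S \<in> F_system m i. Plain n \<in> S}"
    "F_system m i - {S. Plain n \<in> S} = {S \<in> F_system m i. Primed n \<in> S}"
    using iff by blast+
  then have "card (F_system m i)
      = degree (F_system m i) (Plain n) + degree (F_system m i) (Primed n)"
    using card_Int_Diff[OF finite_F_system, of m i "{S. Plain n \<in> S}"]
    by (simp only: degree_def)
  then show ?thesis using degree_F_Plain_Primed[OF assms] by simp
qed

lemma degree_G_Plain:
  assumes "n \<in> {1..m}"
  shows "degree (G_system m) (Plain n) = m - 1"
proof -
  have "{S \<in> G_system m. Plain n \<in> S} = G_block m ` ({1..m} - {n})"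
    using assms G_block_iff(1) unfolding G_system_image by blast
  moreover have "inj_on (G_block m) ({1..m} - {n})"
    using inj_on_G_block by (rule inj_on_subset) blast
  ultimately show ?thesis using assms by (simp add: degree_def card_image)
qed

text \<open>Each \<open>G_p\<close> containing \<open>n'\<close> also contains \<open>n\<close>, but
  the one whose index cyclically precedes \<open>n\<close> contains \<open>n\<close> and not
  \<open>n'\<close>.\<close>

lemma degree_G_Primed_less:
  assumes "m \<ge> 2" "n \<in> {1..m}"
  shows "degree (G_system m) (Primed n) < degree (G_system m) (Plain n)"
  unfolding degree_def
proof (rule psubset_card_mono)
  show "finite {S \<in> G_system m. Plain n \<in> S}" by (simp add: G_system_image)
  \<comment> \<open>The predecessor of \<open>n\<close>, with 1 wrapping around to
    \<open>m\<close>.\<close>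
  obtain p where p: "p \<in> {1..m}" "p \<noteq> n" "n = add_mod m p 1"
  proof (cases "n = 1")
    case True
    then show thesis using assms that[of m] add_mod_1[of m m] by simp
  next
    case False
    then have "n - 1 \<in> {1..m}" "n - 1 \<noteq> n" "n - 1 \<noteq> m" "Suc (n - 1) = n"
      using assms(2) by auto
    then show thesis using assms(1) that[of "n - 1"] add_mod_1[of "n - 1" m] by (simp only: if_False simp_thms)
  qed
  then have "Plain n \<in> G_block m p" "Primed n \<notin> G_block m p" "G_block m p \<in> G_system m"
    using assms(2) unfolding G_block_iff G_system_image by blast+
  then have "G_block m p \<in> {S \<in> G_system m. Plain n \<in> S} - {S \<in> G_system m. Primed n \<in> S}"
    by simp
  moreover have "{S \<in> G_system m. Primed n \<in> S} \<subseteq> {S \<in> G_system m. Plain n \<in> S}"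
    using G_block_iff unfolding G_system_image by blast
  ultimately show "{S \<in> G_system m. Primed n \<in> S} \<subset> {S \<in> G_system m. Plain n \<in> S}"
    by blast
qed

section \<open>Degrees in \<open>M_system\<close>\<close>

lemma finite_M_system: "finite (M_system m i)"
  by (simp add: M_system_def finite_F_system G_system_image)

lemma card_M_system: "card (M_system m i) = card (F_system m i) + m"
proof -
  have "finite (G_system m)" "card (G_system m) = m"
    using card_image[OF inj_on_G_block[of m]] by (simp_all add: G_system_image)
  then show ?thesis
    by (simp add: M_system_def card_Un_disjoint finite_F_system F_G_disjoint)
qed

lemma degree_M_system:
  "degree (M_system m i) x = degree (F_system m i) x + degree (G_system m) x"
  unfolding M_system_def
  by (rule degree_Un_disjoint[OF finite_F_system _ F_G_disjoint]) (simp add: G_system_image)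

text \<open>With \<open>f = card (F_system m i)\<close>, the degree is \<open>f/2 + m - 1\<close>
  and there are \<open>f + m\<close> blocks. Eliminating \<open>f\<close> gives a criterion of the
  same form for both \<open>i\<close>, free of subtraction and division.\<close>

lemma degree_M_Plain:
  assumes "m \<ge> 2" "n \<in> {1..m}"
  shows "2 * degree (M_system m i) (Plain n) + 2 = card (M_system m i) + m"
  using card_F_system[OF assms, of i] degree_G_Plain[OF assms(2)] assms
  by (simp add: degree_M_system card_M_system)

lemma degree_M_Primed_less:
  assumes "m \<ge> 2" "n \<in> {1..m}"
  shows "degree (M_system m i) (Primed n) < degree (M_system m i) (Plain n)"
  using degree_F_Plain_Primed[OF assms] degree_G_Primed_less[OF assms]
  by (simp add: degree_M_system)

lemma M_system_subset: "S \<in> M_system m i \<Longrightarrow> S \<subseteq> E_set m"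
  by (auto simp: M_system_def F_system_def G_system_def F_block_def G_block_def E_set_def)

lemma zero_notin_M: "Plain 0 \<notin> \<Union>(M_system m i)" "Primed 0 \<notin> \<Union>(M_system m i)"
proof -
  have "Plain 0 \<notin> E_set m" "Primed 0 \<notin> E_set m" by (auto simp: E_set_def)
  then show "Plain 0 \<notin> \<Union>(M_system m i)" "Primed 0 \<notin> \<Union>(M_system m i)"
    using M_system_subset by blast+
qed

section \<open>Recognizing the unprimed elements of \<open>E_m\<close> by their degrees in
  \<open>U_odd\<close> and \<open>U_even\<close>\<close>

lemma U_odd_image: "U_odd m i = insert (Plain 0) ` M_system m i"
  by (auto simp: U_odd_def)

lemma card_U_odd: "card (U_odd m i) = card (M_system m i)"
  unfolding U_odd_image by (rule card_image[OF inj_on_insert_new[OF zero_notin_M(1)]])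

lemma degree_U_odd:
  "degree (U_odd m i) x = (if x = Plain 0 then card (M_system m i) else degree (M_system m i) x)"
  unfolding U_odd_image by (rule degree_insert_new[OF zero_notin_M(1)])

lemma U_odd_degree_iff:
  assumes "m \<ge> 2" "x \<in> U_odd_ground m"
  shows "2 * degree (U_odd m i) x + 2 = card (U_odd m i) + m \<longleftrightarrow> x \<in> Plain ` {1..m}"
proof -
  consider "x = Plain 0" | n where "n \<in> {1..m}" "x = Plain n" | n where "n \<in> {1..m}" "x = Primed n"
    using assms(2) by (auto simp: U_odd_ground_def E_set_def)
  then show ?thesis
  proof cases
    \<comment> \<open>The element 0 lies in every block, so the equation would give
      \<open>card (M_system m i) + 2 = m\<close>; but the blocks \<open>G_p\<close> alone number
      \<open>m\<close>.\<close>
    case 1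
    then show ?thesis by (auto simp: degree_U_odd card_U_odd card_M_system)
  next
    case 2
    then show ?thesis using degree_M_Plain[OF assms(1)] by (auto simp: degree_U_odd card_U_odd)
  next
    case 3
    then show ?thesis
      using degree_M_Plain[OF assms(1), of n i] degree_M_Primed_less[OF assms(1), of n i]
      by (auto simp: degree_U_odd card_U_odd)
  qed
qed

lemma finite_U_odd: "finite (U_odd m i)"
  by (simp add: U_odd_image finite_M_system)

lemma U_odd_subset: "U_odd m i \<subseteq> Pow (U_odd_ground m)"
  using M_system_subset unfolding U_odd_image U_odd_ground_def by blast

lemma zero_pair_notin_U_odd: "{Plain 0, Primed 0} \<notin> U_odd m i"
proof -
  have "Primed 0 \<notin> U_odd_ground m" by (auto simp: U_odd_ground_def E_set_def)
  then show ?thesis using U_odd_subset by blast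
qed

lemma card_U_even: "card (U_even m i) = card (U_odd m i) + 1"
  by (simp add: U_even_def zero_pair_notin_U_odd finite_U_odd)

lemma degree_U_even:
  "degree (U_even m i) x = degree (U_odd m i) x + (if x \<in> {Plain 0, Primed 0} then 1 else 0)"
proof -
  have "degree {{Plain 0, Primed 0}} x = (if x \<in> {Plain 0, Primed 0} then 1 else 0)"
  proof -
    have "{S \<in> {{Plain 0, Primed 0}}. x \<in> S}
        = (if x \<in> {Plain 0, Primed 0} then {{Plain 0, Primed 0}} else {})" by auto
    then show ?thesis by (simp add: degree_def)
  qed
  then show ?thesis
    unfolding U_even_def using degree_Un_disjoint[of "U_odd m i" "{{Plain 0, Primed 0}}" x]
    by (simp add: finite_U_odd zero_pair_notin_U_odd)
qed

text \<open>The extra block adds one to the number of blocks and leaves degrees on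
  \<open>E_m\<close> unchanged, which turns the constant 2 of the odd case into 3.\<close>

lemma U_even_degree_iff:
  assumes "m \<ge> 3" "x \<in> U_even_ground m"
  shows "2 * degree (U_even m i) x + 3 = card (U_even m i) + m \<longleftrightarrow> x \<in> Plain ` {1..m}"
proof -
  consider "x = Plain 0" | "x = Primed 0" | "x \<in> U_odd_ground m" "x \<noteq> Plain 0" "x \<noteq> Primed 0"
    using assms(2) by (auto simp: U_odd_ground_def U_even_ground_def E_set_def)
  then show ?thesis
  proof cases
    case 1
    then show ?thesis
      by (auto simp: degree_U_even card_U_even degree_U_odd card_U_odd card_M_system)
  next
    case 2
    \<comment> \<open>The only block containing \<open>0'\<close> is the extra one, so the left side
      is 5, whereas the right side is at least \<open>2 * m + 1 \<ge> 7\<close>.\<close>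
    have "{S \<in> M_system m i. Primed 0 \<in> S} = {}" using zero_notin_M(2)[of m i] by blast
    then have "degree (M_system m i) (Primed 0) = 0" by (simp only: degree_def card.empty)
    with 2 show ?thesis using assms(1)
      by (auto simp: degree_U_even card_U_even degree_U_odd card_U_odd card_M_system)
  next
    case 3
    then show ?thesis using U_odd_degree_iff[of m x i] assms(1)
      by (simp add: degree_U_even card_U_even)
  qed
qed

section \<open>Blocks with exactly one unprimed element of \<open>E_m\<close>\<close>

lemma one_Plain_block_U_odd_1:
  assumes "m \<ge> 1"
  shows "\<exists>S\<in>U_odd m 1. card {x \<in> S. x \<in> Plain ` {1..m}} = 1"
proof
  have "F_block m {1} \<in> F_system m 1"
    unfolding F_system_def mem_Collect_eq using assms by (intro exI[of _ "{1}"]) simp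
  then show "insert (Plain 0) (F_block m {1}) \<in> U_odd m 1"
    by (simp add: U_odd_image M_system_def)
  \<comment> \<open>The range \<open>{1..m}\<close> keeps \<open>Plain 0\<close>, common to all
    blocks, out of the count.\<close>
  have "{x \<in> insert (Plain 0) (F_block m {1}). x \<in> Plain ` {1..m}} = {Plain 1}"
    using assms by (auto simp: F_block_def)
  then show "card {x \<in> insert (Plain 0) (F_block m {1}). x \<in> Plain ` {1..m}} = 1" by simp
qed

lemma no_one_Plain_block_U_odd_2:
  assumes "m \<ge> 3" "S \<in> U_odd m 2"
  shows "card {x \<in> S. x \<in> Plain ` {1..m}} \<noteq> 1"
proof -
  obtain T where T: "S = insert (Plain 0) T" "T \<in> M_system m 2"
    using assms(2) unfolding U_odd_image by blast
  have inj: "inj_on Plain A" for A by (simp add: inj_on_def)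
  have "(\<exists>J. J \<subseteq> {1..m} \<and> even (card J) \<and> T = F_block m J) \<or> (\<exists>p\<in>{1..m}. T = G_block m p)"
    using T(2) unfolding M_system_def F_system_def G_system_def by auto
  then consider J where "J \<subseteq> {1..m}" "even (card J)" "T = F_block m J"
    | p where "p \<in> {1..m}" "T = G_block m p"
    by blast
  then show ?thesis
  proof cases
    case 1
    have "{x \<in> S. x \<in> Plain ` {1..m}} = Plain ` J"
      using \<open>J \<subseteq> {1..m}\<close> unfolding T(1) \<open>T = F_block m J\<close> F_block_def by auto
    then have "card {x \<in> S. x \<in> Plain ` {1..m}} = card J"
      by (simp only: card_image[OF inj])
    then show ?thesis using \<open>even (card J)\<close> by (metis odd_one)
  next
    case 2
    have "{x \<in> S. x \<in> Plain ` {1..m}} = Plain ` ({1..m} - {p})"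
      unfolding T(1) \<open>T = G_block m p\<close> G_block_def E_set_def by auto
    then have "card {x \<in> S. x \<in> Plain ` {1..m}} = card ({1..m} - {p})"
      by (simp only: card_image[OF inj])
    then show ?thesis using \<open>p \<in> {1..m}\<close> assms(1) by simp
  qed
qed

theorem proposition3p18:
  fixes m :: nat
  assumes "m \<ge> 3"
  shows "\<not> isomorphic_systems (U_odd_ground m) (U_odd m 1) (U_odd_ground m) (U_odd m 2)
       \<and> \<not> isomorphic_systems (U_even_ground m) (U_even m 1) (U_even_ground m) (U_even m 2)"
proof (intro conjI notI)
  \<comment> \<open>The same \<open>S\<close> serves both halves, since \<open>U_even m 1\<close>
    includes \<open>U_odd m 1\<close>.\<close>
  obtain S where S: "S \<in> U_odd m 1" "card {x \<in> S. x \<in> Plain ` {1..m}} = 1"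
    using one_Plain_block_U_odd_1[of m] assms by auto
  {
    assume iso: "isomorphic_systems (U_odd_ground m) (U_odd m 1) (U_odd_ground m) (U_odd m 2)"
    have plain: "{x \<in> T. 2 * degree (U_odd m i) x + 2 = card (U_odd m i) + m}
        = {x \<in> T. x \<in> Plain ` {1..m}}" if "T \<in> U_odd m i" for T i
    proof -
      have "T \<subseteq> U_odd_ground m" using that U_odd_subset by blast
      then show ?thesis using U_odd_degree_iff[of m _ i] assms by auto
    qed
    \<comment> \<open>This \<open>Q\<close> is the degree equation that, by \<open>plain\<close>,
      selects exactly the unprimed elements of \<open>E_m\<close>.\<close>
    from isomorphic_systems_block_degrees[OF iso U_odd_subset S(1),
        where Q = "\<lambda>c d. 2 * d + 2 = c + m"]
    obtain T where T: "T \<in> U_odd m 2"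
      "card {y \<in> T. 2 * degree (U_odd m 2) y + 2 = card (U_odd m 2) + m}
        = card {x \<in> S. 2 * degree (U_odd m 1) x + 2 = card (U_odd m 1) + m}"
      by (rule bexE)
    show False
      using T(2) S(2) no_one_Plain_block_U_odd_2[OF assms T(1)]
      unfolding plain[OF T(1)] plain[OF S(1)] by argo
  }
  assume iso: "isomorphic_systems (U_even_ground m) (U_even m 1) (U_even_ground m) (U_even m 2)"
  have sub: "U_even m i \<subseteq> Pow (U_even_ground m)" for i
    using sperner_systemD(2)[OF sperner_U_even[OF assms]] .
  have plain: "{x \<in> T. 2 * degree (U_even m i) x + 3 = card (U_even m i) + m}
      = {x \<in> T. x \<in> Plain ` {1..m}}" if "T \<in> U_even m i" for T i
  proof -
    have "T \<subseteq> U_even_ground m" using that sub by blast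
    then show ?thesis using U_even_degree_iff[OF assms, of _ i] by auto
  qed
  have S': "S \<in> U_even m 1" using S by (simp add: U_even_def)
  from isomorphic_systems_block_degrees[OF iso sub S', where Q = "\<lambda>c d. 2 * d + 3 = c + m"]
  obtain T where "T \<in> U_even m 2"
    "card {y \<in> T. 2 * degree (U_even m 2) y + 3 = card (U_even m 2) + m}
      = card {x \<in> S. 2 * degree (U_even m 1) x + 3 = card (U_even m 1) + m}"
    by (rule bexE)
  then have T: "T \<in> U_even m 2" "card {x \<in> T. x \<in> Plain ` {1..m}} = 1"
    using S(2) plain[OF S'] plain[of T 2] by simp_all
  \<comment> \<open>The extra block has no unprimed element of \<open>E_m\<close>, so
    \<open>T\<close> is a block of \<open>U_odd m 2\<close> and the odd case applies.\<close>
  have "{x \<in> {Plain 0, Primed 0}. x \<in> Plain ` {1..m}} = {}" by auto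
  then have "T \<noteq> {Plain 0, Primed 0}" using T(2) by (metis card.empty zero_neq_one)
  then show False using T no_one_Plain_block_U_odd_2[OF assms] by (auto simp: U_even_def)
qed

end
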